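(* Let $\nu$ be a probability measure on $\mathbb{R}$ such that $\nu\{0\}<1$. Then any unbiased shift $T$ embedding $\nu$ satisfies $$\mathbb{P}_0\{T=0\}=0.$$
   Context: Let $\Omega$ be the set of continuous functions $\omega:\mathbb{R}\to\mathbb{R}$ with the Kolmogorov product $\sigma$-algebra, let $B=(B_t)_{t\in\mathbb{R}}$ be the identity (coordinate process) on $\Omega$, and let $\mathbb{P}_0$ be the law of a two-sided standard Brownian motion with $B_0=0$. A random time is a measurable function $T$ of $B$ with values in $\mathbb{R}$ (of arbitrary sign, not assumed to be a stopping time). $T$ is an unbiased shift if, under $\mathbb{P}_0$, $(B_{T+t}-B_T)_{t\in\mathbb{R}}$ is a two-sided standard Brownian motion independent of $B_T$. $T$ embeds $\nu$ if $B_T$ has distribution $\nu$ under $\mathbb{P}_0$. *)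

theory Defs
  imports "HOL-Probability.Probability"
begin

text \<open>The continuous functions on the real line with the trace of the Kolmogorov product
  \<open>\<sigma>\<close>-algebra, that is, the \<open>\<sigma>\<close>-algebra generated by the coordinate maps.\<close>

definition path_space :: "(real \<Rightarrow> real) measure" where
  "path_space = restrict_space (\<Pi>\<^sub>M t\<in>UNIV. borel) {\<omega>. continuous_on UNIV \<omega>}"

lemma space_path_space: "space path_space = {\<omega>. continuous_on UNIV \<omega>}"
  by (simp add: path_space_def space_restrict_space space_PiM)

text \<open>``Standard'' includes that the process starts (almost surely) at 0 at time 0. Given this,
  independence and normality of the increments over the whole line amount to the two halves of
  the process, before and after time 0, being independent one-sided standard Brownian motions.
  The second parameter of \<^const>\<open>normal_density\<close> is the standard deviation.\<close>

definition two_sided_BM :: "'a measure \<Rightarrow> (real \<Rightarrow> 'a \<Rightarrow> real) \<Rightarrow> bool" where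
  "two_sided_BM M X \<longleftrightarrow>
     prob_space M \<and>
     (\<forall>t. X t \<in> borel_measurable M) \<and>
     (\<forall>\<omega>\<in>space M. continuous_on UNIV (\<lambda>t. X t \<omega>)) \<and>
     (AE \<omega> in M. X 0 \<omega> = 0) \<and>
     (\<forall>s t. s < t \<longrightarrow>
        distributed M lborel (\<lambda>\<omega>. X t \<omega> - X s \<omega>) (normal_density 0 (sqrt (t - s)))) \<and>
     (\<forall>(n::nat) (t::nat \<Rightarrow> real). strict_mono_on {..n} t \<longrightarrow>
        prob_space.indep_vars M (\<lambda>_. borel) (\<lambda>i \<omega>. X (t (Suc i)) \<omega> - X (t i) \<omega>) {..<n})"

text \<open>\<open>P\<close> is the law \<open>\<bbbP>\<^sub>0\<close> on path space, under which the coordinate process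
  is a two-sided standard Brownian motion.\<close>

definition BM_law :: "(real \<Rightarrow> real) measure \<Rightarrow> bool" where
  "BM_law P \<longleftrightarrow> sets P = sets path_space \<and> two_sided_BM P (\<lambda>t \<omega>. \<omega> t)"

text \<open>The library's \<open>indep_var\<close> requires both random elements to take values in the
  same type; this is the same notion for two different types.\<close>

definition indep_elements ::
  "'a measure \<Rightarrow> 'b measure \<Rightarrow> ('a \<Rightarrow> 'b) \<Rightarrow> 'c measure \<Rightarrow> ('a \<Rightarrow> 'c) \<Rightarrow> bool" where
  "indep_elements M N X K Y \<longleftrightarrow>
     X \<in> M \<rightarrow>\<^sub>M N \<and> Y \<in> M \<rightarrow>\<^sub>M K \<and>
     prob_space.indep_set M {X -` A \<inter> space M |A. A \<in> sets N} {Y -` A \<inter> space M |A. A \<in> sets K}"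

lemma (in prob_space) indep_elements_eq_indep_var:
  "indep_elements M N X K Y \<longleftrightarrow> indep_var N X K Y"
proof -
  have "case_bool {X -` A \<inter> space M |A. A \<in> sets N} {Y -` A \<inter> space M |A. A \<in> sets K} =
    (\<lambda>i. {case_bool X Y i -` A \<inter> space M |A. A \<in> sets (case_bool N K i)})"
    by (rule ext) (auto split: bool.splits)
  then show ?thesis
    unfolding indep_elements_def indep_var_def indep_set_def indep_vars_def2
    by (auto simp: UNIV_bool)
qed

text \<open>A random time may take either sign and need not be a stopping time. Independence from the
  shifted process means independence from that process as a random element of path space.\<close>

definition unbiased_shift ::
  "(real \<Rightarrow> real) measure \<Rightarrow> ((real \<Rightarrow> real) \<Rightarrow> real) \<Rightarrow> bool" where
  "unbiased_shift P T \<longleftrightarrow>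
     T \<in> borel_measurable P \<and>
     two_sided_BM P (\<lambda>t \<omega>. \<omega> (T \<omega> + t) - \<omega> (T \<omega>)) \<and>
     indep_elements P path_space (\<lambda>\<omega> t. \<omega> (T \<omega> + t) - \<omega> (T \<omega>))
       borel (\<lambda>\<omega>. \<omega> (T \<omega>))"

definition embeds ::
  "(real \<Rightarrow> real) measure \<Rightarrow> ((real \<Rightarrow> real) \<Rightarrow> real) \<Rightarrow> real measure \<Rightarrow> bool" where
  "embeds P T \<nu> \<longleftrightarrow> distr P borel (\<lambda>\<omega>. \<omega> (T \<omega>)) = \<nu>"

end

theory Submission
  imports Defs
begin

text \<open>Let \<open>W\<close> be the shifted process and \<open>A = {T = 0}\<close>. On \<open>A\<close> the shift does nothing, so up to null
  sets \<open>A\<close> is contained in the event that \<open>W \<in> A\<close> and \<open>B\<^sub>T = 0\<close>. By independence, and because \<open>W\<close> has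
  law \<open>P\<close>, that event has probability \<open>P(A) \<cdot> \<nu>{0}\<close>. Hence \<open>P(A) \<le> P(A) \<cdot> \<nu>{0}\<close>, which
  forces \<open>P(A) = 0\<close>.\<close>

text \<open>Turns a finite set of times into a grid of the kind that the independence clause of
  \<open>two_sided_BM\<close> speaks of. The last index is \<open>n\<close>, so the grid has
  \<open>n + 1\<close> points and \<open>n\<close> increments.\<close>

lemma finite_set_strict_mono_enum:
  fixes J :: "'a::linorder set"
  assumes "finite J" "J \<noteq> {}"
  obtains n and t :: "nat \<Rightarrow> 'a" where "strict_mono_on {..n} t" "J = t ` {..n}"
proof -
  let ?xs = "sorted_list_of_set J"
  define n where "n = length ?xs - 1"
  have set: "set ?xs = J" and ne: "?xs \<noteq> []"
    using assms by auto
  \<comment> \<open>Nonemptiness matters: for an empty list the truncated subtraction would give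
    \<open>n = 0\<close>, and \<open>{..n}\<close> would still contain an index.\<close>
  then have lt: "i \<le> n \<longleftrightarrow> i < length ?xs" for i
    by (cases ?xs) (auto simp: n_def)
  have "strict_mono_on {..n} (\<lambda>i. ?xs ! i)"
    using sorted_wrt_nth_less[OF strict_sorted_list_of_set] by (auto simp: strict_mono_on_def lt)
  moreover have "J = (\<lambda>i. ?xs ! i) ` {..n}"
    using lt by (subst set[symmetric]) (auto simp: set_conv_nth)
  ultimately show thesis by (rule that)
qed

context
  fixes M :: "'a measure" and X :: "real \<Rightarrow> 'a \<Rightarrow> real"
  assumes BM: "two_sided_BM M X"
begin

interpretation prob_space M
  using BM by (simp add: two_sided_BM_def)

lemma two_sided_BM_measurable: "X t \<in> borel_measurable M"
  using BM by (simp add: two_sided_BM_def)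

text \<open>Independence makes the joint law a product, and each factor is the prescribed Gaussian.
  The resulting measure mentions neither \<open>M\<close> nor \<open>X\<close>, which is what allows
  two Brownian motions on different spaces to be compared.\<close>

lemma two_sided_BM_distr_increments:
  assumes t: "strict_mono_on {..n} t" and n: "n > 0"
  shows "distr M (\<Pi>\<^sub>M i\<in>{..<n}. borel) (\<lambda>\<omega>. \<lambda>i\<in>{..<n}. X (t (Suc i)) \<omega> - X (t i) \<omega>) =
    (\<Pi>\<^sub>M i\<in>{..<n}. density lborel (normal_density 0 (sqrt (t (Suc i) - t i))))"
proof -
  note [measurable] = two_sided_BM_measurable
  have "indep_vars (\<lambda>_. borel) (\<lambda>i \<omega>. X (t (Suc i)) \<omega> - X (t i) \<omega>) {..<n}"
    using BM t by (simp add: two_sided_BM_def)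
  \<comment> \<open>The product characterisation of independence needs a nonempty index set, hence
    \<open>n > 0\<close>.\<close>
  then have "distr M (\<Pi>\<^sub>M i\<in>{..<n}. borel) (\<lambda>\<omega>. \<lambda>i\<in>{..<n}. X (t (Suc i)) \<omega> - X (t i) \<omega>) =
      (\<Pi>\<^sub>M i\<in>{..<n}. distr M borel (\<lambda>\<omega>. X (t (Suc i)) \<omega> - X (t i) \<omega>))"
    using n by (subst (asm) indep_vars_iff_distr_eq_PiM) auto
  also have "\<dots> = (\<Pi>\<^sub>M i\<in>{..<n}. density lborel (normal_density 0 (sqrt (t (Suc i) - t i))))"
  proof (rule PiM_cong)
    fix i assume "i \<in> {..<n}"
    then have "t i < t (Suc i)"
      using t by (auto simp: strict_mono_on_def)
    then have "distr M lborel (\<lambda>\<omega>. X (t (Suc i)) \<omega> - X (t i) \<omega>) =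
        density lborel (normal_density 0 (sqrt (t (Suc i) - t i)))"
      using BM by (simp add: two_sided_BM_def distributed_def)
    then show "distr M borel (\<lambda>\<omega>. X (t (Suc i)) \<omega> - X (t i) \<omega>) =
        density lborel (normal_density 0 (sqrt (t (Suc i) - t i)))"
      by (simp cong: distr_cong)
  qed simp
  finally show ?thesis .
qed

text \<open>Since the path vanishes at \<open>t k = 0\<close>, its values are partial sums of increments.\<close>

lemma two_sided_BM_cylinder_emeasure:
  assumes t: "strict_mono_on {..n} t" and n: "n > 0" and k: "k \<le> n" "t k = 0"
    and I: "I \<subseteq> {..n}" and A: "\<And>i. i \<in> I \<Longrightarrow> A i \<in> sets borel"
  shows "emeasure M {\<omega>\<in>space M. \<forall>i\<in>I. X (t i) \<omega> \<in> A i} =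
    emeasure (\<Pi>\<^sub>M i\<in>{..<n}. density lborel (normal_density 0 (sqrt (t (Suc i) - t i))))
      {d\<in>space (\<Pi>\<^sub>M i\<in>{..<n}. borel). \<forall>i\<in>I. (\<Sum>l<i. d l) - (\<Sum>l<k. d l) \<in> A i}"
    (is "_ = emeasure _ ?E")
proof -
  note [measurable] = two_sided_BM_measurable
  let ?D = "\<lambda>\<omega>. \<lambda>i\<in>{..<n}. X (t (Suc i)) \<omega> - X (t i) \<omega>"
  have "finite I"
    using I finite_subset by blast
  have sum [measurable]: "(\<lambda>d. \<Sum>l<i. d l) \<in> borel_measurable (\<Pi>\<^sub>M i\<in>{..<n}. borel :: real measure)"
    if "i \<le> n" for i
    using that by (intro borel_measurable_sum measurable_component_singleton) auto
  have E: "?E \<in> sets (\<Pi>\<^sub>M i\<in>{..<n}. borel)"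
  proof (rule sets.sets_Collect_finite_All)
    fix i assume i: "i \<in> I"
    have "(\<lambda>d. (\<Sum>l<i. d l) - (\<Sum>l<k. d l)) \<in> borel_measurable (\<Pi>\<^sub>M i\<in>{..<n}. borel :: real measure)"
      using I i k by (intro borel_measurable_diff sum) auto
    from measurable_sets[OF this A[OF i]]
    show "{d \<in> space (\<Pi>\<^sub>M i\<in>{..<n}. borel). (\<Sum>l<i. d l) - (\<Sum>l<k. d l) \<in> A i}
        \<in> sets (\<Pi>\<^sub>M i\<in>{..<n}. borel)"
      by (simp add: vimage_def Int_def conj_commute)
  qed fact
  have D: "?D \<in> M \<rightarrow>\<^sub>M (\<Pi>\<^sub>M i\<in>{..<n}. borel)"
    by measurable
  \<comment> \<open>The grid may begin before time 0, so the increments telescope down to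
    \<open>t 0\<close>; subtracting the sum up to \<open>k\<close> moves the reference point to
    \<open>t k = 0\<close>.\<close>
  have partial: "(\<Sum>l<i. ?D \<omega> l) - (\<Sum>l<k. ?D \<omega> l) = X (t i) \<omega> - X (t k) \<omega>" if "i \<le> n" for i \<omega>
  proof -
    have "(\<Sum>l<j. ?D \<omega> l) = X (t j) \<omega> - X (t 0) \<omega>" if "j \<le> n" for j
      using that by (simp add: sum_lessThan_telescope[where f = "\<lambda>i. X (t i) \<omega>", symmetric])
    then show ?thesis
      using that k by simp
  qed
  have 0: "AE \<omega> in M. X 0 \<omega> = 0"
    using BM by (simp add: two_sided_BM_def)
  \<comment> \<open>The two events agree only up to a null set, because \<open>X 0 = 0\<close> holds
    only almost surely.\<close>
  have "emeasure M {\<omega>\<in>space M. \<forall>i\<in>I. X (t i) \<omega> \<in> A i} = emeasure M (?D -` ?E \<inter> space M)"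
  proof (rule emeasure_eq_AE)
    show "AE \<omega> in M. \<omega> \<in> {\<omega>\<in>space M. \<forall>i\<in>I. X (t i) \<omega> \<in> A i} \<longleftrightarrow> \<omega> \<in> ?D -` ?E \<inter> space M"
      using 0
    proof (rule AE_mp, intro AE_I2 impI)
      fix \<omega> assume \<omega>: "\<omega> \<in> space M" "X 0 \<omega> = 0"
      have "?D \<omega> \<in> space (\<Pi>\<^sub>M i\<in>{..<n}. borel)"
        using D \<omega>(1) by (rule measurable_space)
      moreover have "(\<forall>i\<in>I. (\<Sum>l<i. ?D \<omega> l) - (\<Sum>l<k. ?D \<omega> l) \<in> A i) \<longleftrightarrow> (\<forall>i\<in>I. X (t i) \<omega> \<in> A i)"
      proof (intro ball_cong refl)
        fix i assume "i \<in> I"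
        then have "i \<le> n"
          using I by auto
        then show "(\<Sum>l<i. ?D \<omega> l) - (\<Sum>l<k. ?D \<omega> l) \<in> A i \<longleftrightarrow> X (t i) \<omega> \<in> A i"
          by (simp only: partial k \<omega> diff_0_right)
      qed
      ultimately show "\<omega> \<in> {\<omega>\<in>space M. \<forall>i\<in>I. X (t i) \<omega> \<in> A i} \<longleftrightarrow> \<omega> \<in> ?D -` ?E \<inter> space M"
        using \<omega>(1) by blast
    qed
    show "{\<omega>\<in>space M. \<forall>i\<in>I. X (t i) \<omega> \<in> A i} \<in> sets M"
      using \<open>finite I\<close> A by measurable
    show "?D -` ?E \<inter> space M \<in> sets M"
      using D E by (rule measurable_sets)
  qed
  also have "\<dots> = emeasure (distr M (\<Pi>\<^sub>M i\<in>{..<n}. borel) ?D) ?E"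
    using D E by (simp add: emeasure_distr)
  finally show ?thesis
    by (simp only: two_sided_BM_distr_increments[OF t n])
qed

end

text \<open>A finite measure on the product is determined by its values on cylinders over finitely
  many times, and for both processes these values are the same Gaussian expression in the times
  alone.\<close>

lemma two_sided_BM_distr_eq:
  assumes X: "two_sided_BM M X" and Y: "two_sided_BM N Y"
  shows "distr M (\<Pi>\<^sub>M t\<in>UNIV. borel) (\<lambda>\<omega> t. X t \<omega>) = distr N (\<Pi>\<^sub>M t\<in>UNIV. borel) (\<lambda>\<omega> t. Y t \<omega>)"
    (is "?P = ?Q")
proof (rule measure_eqI_PiM_infinite)
  let ?B = "\<Pi>\<^sub>M t\<in>(UNIV :: real set). (borel :: real measure)"
  have mX: "(\<lambda>\<omega> t. X t \<omega>) \<in> M \<rightarrow>\<^sub>M ?B" and mY: "(\<lambda>\<omega> t. Y t \<omega>) \<in> N \<rightarrow>\<^sub>M ?B"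
    using two_sided_BM_measurable[OF X] two_sided_BM_measurable[OF Y]
    by (auto intro!: measurable_PiM_single' simp: space_PiM)
  show "finite_measure ?P"
    using X mX by (auto simp: two_sided_BM_def intro!: prob_space.finite_measure prob_space.prob_space_distr)
  fix A :: "real \<Rightarrow> real set" and J :: "real set"
  assume J: "finite J" and A: "\<And>i. i \<in> J \<Longrightarrow> A i \<in> sets borel"
  \<comment> \<open>Time 0 is added as the reference point of the path; time 1 only guarantees a
    second grid point, so that \<open>n > 0\<close> even when \<open>J\<close> is empty or
    \<open>{0}\<close>.\<close>
  obtain n t where t: "strict_mono_on {..n} t" and nt: "insert 0 (insert 1 J) = t ` {..n::nat}"
    using finite_set_strict_mono_enum[of "insert 0 (insert 1 J)"] J by auto
  have "0 \<in> t ` {..n}" "1 \<in> t ` {..n}"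
    unfolding nt[symmetric] by auto
  then obtain k l where k: "k \<le> n" "t k = 0" and l: "l \<le> n" "t l = 1"
    by auto
  then have n: "n > 0"
    by (cases "n = 0") auto
  \<comment> \<open>Only grid points from \<open>J\<close> are constrained; an added 0 or 1 outside
    \<open>J\<close> is left free.\<close>
  define I where "I = {i. i \<le> n \<and> t i \<in> J}"
  have tI: "t ` I = J"
    using nt by (auto simp: I_def)
  have emb: "prod_emb UNIV (\<lambda>_. borel) J (Pi\<^sub>E J A) = {x. \<forall>i\<in>I. x (t i) \<in> A (t i)}"
    by (auto simp: prod_emb_def space_PiM PiE_iff tI[symmetric])
  have sets: "prod_emb UNIV (\<lambda>_. borel) J (Pi\<^sub>E J A) \<in> sets ?B"
    using J A by (intro sets_PiM_I) auto
  have I: "I \<subseteq> {..n}" and AI: "\<And>i. i \<in> I \<Longrightarrow> A (t i) \<in> sets borel"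
    using A by (auto simp: I_def)
  show "emeasure ?P (prod_emb UNIV (\<lambda>_. borel) J (Pi\<^sub>E J A)) =
      emeasure ?Q (prod_emb UNIV (\<lambda>_. borel) J (Pi\<^sub>E J A))"
    using two_sided_BM_cylinder_emeasure[where A = "\<lambda>i. A (t i)", OF X t n k I AI]
      two_sided_BM_cylinder_emeasure[where A = "\<lambda>i. A (t i)", OF Y t n k I AI]
    unfolding emeasure_distr[OF mX sets] emeasure_distr[OF mY sets]
    unfolding emb
    by (simp add: vimage_def Int_def conj_commute)
qed simp_all

text \<open>Carries uniqueness of the law from the full product over to path space: an event there
  is the trace of a product event \<open>C\<close>, and intersecting with the continuous paths
  changes no preimage, since both processes take values in path space.\<close>

lemma two_sided_BM_distr_BM_law:
  assumes P: "BM_law P" and X: "two_sided_BM M X"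
    and mX: "(\<lambda>\<omega> t. X t \<omega>) \<in> M \<rightarrow>\<^sub>M path_space"
  shows "distr M path_space (\<lambda>\<omega> t. X t \<omega>) = P"
proof (rule measure_eqI)
  show "sets (distr M path_space (\<lambda>\<omega> t. X t \<omega>)) = sets P"
    using P by (simp add: BM_law_def)
  have Y: "two_sided_BM P (\<lambda>t \<omega>. \<omega> t)"
    using P by (simp add: BM_law_def)
  let ?B = "\<Pi>\<^sub>M t\<in>(UNIV :: real set). (borel :: real measure)"
  have id: "(\<lambda>\<omega>. \<omega>) \<in> path_space \<rightarrow>\<^sub>M ?B"
    by (simp add: path_space_def measurable_restrict_space1)
  have sP: "sets P = sets path_space"
    using P by (simp add: BM_law_def)
  then have mP: "(\<lambda>\<omega>. \<omega>) \<in> P \<rightarrow>\<^sub>M ?B"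
    using id by (simp cong: measurable_cong_sets)
  have mX': "(\<lambda>\<omega> t. X t \<omega>) \<in> M \<rightarrow>\<^sub>M ?B"
    using measurable_compose[OF mX id] by simp
  fix S assume S: "S \<in> sets (distr M path_space (\<lambda>\<omega> t. X t \<omega>))"
  then have "S \<in> sets path_space"
    by simp
  then obtain C where C: "C \<in> sets ?B" "S = C \<inter> space path_space"
    unfolding space_path_space by (auto simp: path_space_def sets_restrict_space Int_commute)
  have "emeasure (distr M path_space (\<lambda>\<omega> t. X t \<omega>)) S =
      emeasure M ((\<lambda>\<omega> t. X t \<omega>) -` S \<inter> space M)"
    using S mX by (simp add: emeasure_distr)
  also have "(\<lambda>\<omega> t. X t \<omega>) -` S \<inter> space M = (\<lambda>\<omega> t. X t \<omega>) -` C \<inter> space M"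
    using measurable_space[OF mX] C by auto
  also have "emeasure M \<dots> = emeasure (distr M ?B (\<lambda>\<omega> t. X t \<omega>)) C"
    using mX' C by (simp add: emeasure_distr)
  also have "\<dots> = emeasure (distr P ?B (\<lambda>\<omega>. \<omega>)) C"
    using two_sided_BM_distr_eq[OF X Y] by simp
  also have "\<dots> = emeasure P S"
    using mP C sets_eq_imp_space_eq[OF sP] by (simp add: emeasure_distr)
  finally show "emeasure (distr M path_space (\<lambda>\<omega> t. X t \<omega>)) S = emeasure P S" .
qed

theorem theorem1p5:
  fixes P :: "(real \<Rightarrow> real) measure"
    and \<nu> :: "real measure"
    and T :: "(real \<Rightarrow> real) \<Rightarrow> real"
  assumes "BM_law P"
    and "prob_space \<nu>" and "sets \<nu> = sets borel"
    and "measure \<nu> {0} < 1"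
    and "unbiased_shift P T"
    and "embeds P T \<nu>"
  shows "measure P {\<omega> \<in> space P. T \<omega> = 0} = 0"
proof -
  have BM: "two_sided_BM P (\<lambda>t \<omega>. \<omega> t)" and sP: "sets P = sets path_space"
    using assms(1) by (auto simp: BM_law_def)
  interpret prob_space P
    using BM by (simp add: two_sided_BM_def)
  let ?W = "\<lambda>\<omega> t. \<omega> (T \<omega> + t) - \<omega> (T \<omega>)"
  have T [measurable]: "T \<in> borel_measurable P"
    and W: "two_sided_BM P (\<lambda>t \<omega>. \<omega> (T \<omega> + t) - \<omega> (T \<omega>))"
    and mW: "?W \<in> P \<rightarrow>\<^sub>M path_space"
    and mBT: "(\<lambda>\<omega>. \<omega> (T \<omega>)) \<in> borel_measurable P"
    and indep: "indep_set {?W -` A \<inter> space P |A. A \<in> sets path_space}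
      {(\<lambda>\<omega>. \<omega> (T \<omega>)) -` A \<inter> space P |A. A \<in> sets borel}"
    using assms(5) by (auto simp: unbiased_shift_def indep_elements_def)
  let ?A = "{\<omega> \<in> space P. T \<omega> = 0}"
  let ?WA = "?W -` ?A \<inter> space P" and ?Z = "(\<lambda>\<omega>. \<omega> (T \<omega>)) -` {0} \<inter> space P"
  have A: "?A \<in> sets P"
    by measurable
  have WA: "prob ?WA = prob ?A"
    \<comment> \<open>The shifted process has law \<open>P\<close> by uniqueness of the Brownian
      law.\<close>
    using measure_distr[OF mW, of ?A] A sP two_sided_BM_distr_BM_law[OF assms(1) W mW] by simp
  have Z: "prob ?Z = measure \<nu> {0}"
    using assms(6) measure_distr[OF mBT, of "{0}"] by (simp add: embeds_def)
  have "AE \<omega> in P. \<omega> 0 = 0"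
    using BM by (simp add: two_sided_BM_def)
  \<comment> \<open>If \<open>T \<omega> = 0\<close> and \<open>\<omega> 0 = 0\<close>, then
    \<open>?W \<omega> t = \<omega> t - \<omega> 0 = \<omega> t\<close>, so \<open>T\<close> also
    vanishes at \<open>?W \<omega>\<close>, and \<open>\<omega> (T \<omega>) = 0\<close>.\<close>
  then have "AE \<omega> in P. \<omega> \<in> ?A \<longrightarrow> \<omega> \<in> ?WA \<inter> ?Z"
    by (rule AE_mp) auto
  moreover have "?WA \<inter> ?Z \<in> sets P"
    using measurable_sets[OF mW, of ?A] measurable_sets[OF mBT, of "{0}"] A sP by auto
  ultimately have "prob ?A \<le> prob (?WA \<inter> ?Z)"
    by (rule finite_measure_mono_AE)
  also have "\<dots> = prob ?WA * prob ?Z"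
  proof (rule indep_setD[OF indep])
    \<comment> \<open>The event \<open>?A\<close> is itself a measurable set of paths, so
      \<open>?WA\<close> is determined by the shifted process.\<close>
    show "?WA \<in> {?W -` A \<inter> space P |A. A \<in> sets path_space}"
      by (intro CollectI exI[of _ ?A] conjI refl A[unfolded sP])
    show "?Z \<in> {(\<lambda>\<omega>. \<omega> (T \<omega>)) -` A \<inter> space P |A. A \<in> sets borel}"
      by (intro CollectI exI[of _ "{0}"] conjI refl) simp
  qed
  also have "\<dots> = prob ?A * measure \<nu> {0}"
    by (simp only: WA Z)
  finally have "prob ?A * (1 - measure \<nu> {0}) \<le> 0"
    by (simp add: algebra_simps)
  \<comment> \<open>The second factor is strictly positive because \<open>\<nu>\<close> is not
    concentrated at 0.\<close>
  with assms(4) have "prob ?A \<le> 0"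
    by (simp add: mult_le_0_iff)
  then show ?thesis
    using measure_nonneg[of P ?A] by linarith
qed

end
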